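(* Let $n_v\ge 1$, $N\ge 1$, and let $i_l,j_l,k_l$ ($l=1,\dots,n_v$) be integers modulo $N$ with $i_1=j_1=k_1=0$. Let $$H_4=\begin{bmatrix}1&\cdots&1\\ x^{i_1}&\cdots&x^{i_{n_v}}\\ x^{j_1}&\cdots&x^{j_{n_v}}\\ x^{k_1}&\cdots&x^{k_{n_v}}\end{bmatrix},$$ a $4N\times n_vN$ matrix. Then $\mathrm{girth}(H_4)>4$ if and only if each one of the six sets $$\{i_1,\dots,i_{n_v}\},\ \{j_1,\dots,j_{n_v}\},\ \{k_1,\dots,k_{n_v}\},$$ $$\{i_1-j_1,\dots,i_{n_v}-j_{n_v}\},\ \{i_1-k_1,\dots,i_{n_v}-k_{n_v}\},\ \{j_1-k_1,\dots,j_{n_v}-k_{n_v}\}$$ is of maximal size.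
   Context: $x^r$ denotes the $N\times N$ circulant permutation matrix obtained from the identity by cyclically shifting to the left by $r$ positions; exponents are taken modulo $N$, and $1=x^0$ is the $N\times N$ identity. An indexed set is "of maximal size" if all its listed values, for different indices, are distinct modulo $N$ (here: each set has $n_v$ distinct elements in $\mathbb Z/N\mathbb Z$). The Tanner graph of a $0/1$ matrix is the bipartite graph with one check node per row, one variable node per column, and an edge for each entry equal to $1$; $\mathrm{girth}(M)$ is the length of a shortest cycle in the Tanner graph of $M$ ($+\infty$ if there is none). *)

theory Defs
  imports "HOL-Number_Theory.Cong" "HOL-Library.Extended_Nat" "Jordan_Normal_Form.Matrix"
begin

type_synonym 'v ugraph = "'v set \<times> 'v set set"

(* A cycle is given by the list of its pairwise distinct vertices (the last one being adjacent
   to the first), so the length of the list is the length of the cycle. *)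
definition is_cycle :: "'v ugraph \<Rightarrow> 'v list \<Rightarrow> bool" where
  "is_cycle G vs \<longleftrightarrow> length vs \<ge> 3 \<and> distinct vs \<and> set vs \<subseteq> fst G \<and>
     (\<forall>t < length vs. {vs ! t, vs ! (Suc t mod length vs)} \<in> snd G)"

(* The infimum of the empty set is infinity. *)
definition girth :: "'v ugraph \<Rightarrow> enat" where
  "girth G = (INF vs \<in> {vs. is_cycle G vs}. enat (length vs))"

(* Check nodes (rows) are tagged Inl, variable nodes (columns) are tagged Inr. *)
definition tanner_graph :: "int mat \<Rightarrow> (nat + nat) ugraph" where
  "tanner_graph M =
     (Inl ` {..<dim_row M} \<union> Inr ` {..<dim_col M},
      {{Inl r, Inr c} | r c. r < dim_row M \<and> c < dim_col M \<and> M $$ (r, c) = 1})"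

(* Shifting the identity to the left by r positions moves column b + r to column b. *)
definition circ_perm :: "nat \<Rightarrow> int \<Rightarrow> int mat" where
  "circ_perm N r = mat N N (\<lambda>(a, b). 1\<^sub>m N $$ (a, nat ((int b + r) mod int N)))"

(* The (m * N) x (n * N) matrix of circulant blocks with exponents E p l; block rows and block
   columns are indexed by p < m and l < n. *)
definition circ_block_mat :: "nat \<Rightarrow> nat \<Rightarrow> nat \<Rightarrow> (nat \<Rightarrow> nat \<Rightarrow> int) \<Rightarrow> int mat" where
  "circ_block_mat N m n E = mat (m * N) (n * N)
     (\<lambda>(r, c). circ_perm N (E (r div N) (c div N)) $$ (r mod N, c mod N))"

(* The exponent sequences i, j, k are indexed from 1 to n. *)
definition H4 :: "nat \<Rightarrow> nat \<Rightarrow> (nat \<Rightarrow> int) \<Rightarrow> (nat \<Rightarrow> int) \<Rightarrow> (nat \<Rightarrow> int) \<Rightarrow> int mat" where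
  "H4 N n i j k = circ_block_mat N 4 n (\<lambda>p l. ([\<lambda>_. 0, i, j, k] ! p) (Suc l))"

definition maximal_size :: "nat \<Rightarrow> nat \<Rightarrow> (nat \<Rightarrow> int) \<Rightarrow> bool" where
  "maximal_size N n f \<longleftrightarrow>
     (\<forall>l \<in> {1..n}. \<forall>l' \<in> {1..n}. l \<noteq> l' \<longrightarrow> \<not> [f l = f l'] (mod int N))"

end

theory Submission
  imports Defs
begin

text \<open>
  A cycle of length at most four in a Tanner graph consists of two rows and two columns whose four
  common entries are 1. In a matrix of circulant blocks such a configuration, lying in block rows
  \<open>p, q\<close> and block columns \<open>l, l'\<close>, forces both exponent differences \<open>E p l - E q l\<close> and
  \<open>E p l' - E q l'\<close> to equal the difference of the two row positions modulo \<open>N\<close>. Conversely, if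
  these two differences agree modulo \<open>N\<close>, the four circulants close up to a 4-cycle. The six sets
  are the differences of the six pairs of block rows.
\<close>

text \<open>Both orders of a pair occur, since a cycle runs from rows to columns and back; the last
  two facts express bipartiteness.\<close>

lemma tanner_edge_iff [simp]:
  "{Inl r, Inr c} \<in> snd (tanner_graph M) \<longleftrightarrow> r < dim_row M \<and> c < dim_col M \<and> M $$ (r, c) = 1"
  "{Inr c, Inl r} \<in> snd (tanner_graph M) \<longleftrightarrow> r < dim_row M \<and> c < dim_col M \<and> M $$ (r, c) = 1"
  "{Inl r, Inl r'} \<notin> snd (tanner_graph M)"
  "{Inr c, Inr c'} \<notin> snd (tanner_graph M)"
  by (auto simp: tanner_graph_def doubleton_eq_iff)

lemma is_cycle_3:
  "is_cycle G [a, b, c] \<longleftrightarrow> distinct [a, b, c] \<and> {a, b, c} \<subseteq> fst G \<and>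
     {a, b} \<in> snd G \<and> {b, c} \<in> snd G \<and> {c, a} \<in> snd G"
  by (simp add: is_cycle_def All_less_Suc, blast)

lemma is_cycle_4:
  "is_cycle G [a, b, c, d] \<longleftrightarrow> distinct [a, b, c, d] \<and> {a, b, c, d} \<subseteq> fst G \<and>
     {a, b} \<in> snd G \<and> {b, c} \<in> snd G \<and> {c, d} \<in> snd G \<and> {d, a} \<in> snd G"
  by (simp add: is_cycle_def All_less_Suc, blast)

lemma girth_gt_iff: "girth G > enat g \<longleftrightarrow> (\<forall>vs. is_cycle G vs \<longrightarrow> length vs > g)"
proof -
  \<comment> \<open>A strict bound does not pass through an infimum in general; the bound
    \<open>enat (Suc g) \<le> girth G\<close> does.\<close>
  have "girth G > enat g \<longleftrightarrow> enat (Suc g) \<le> girth G"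
    by (simp add: Suc_ile_eq)
  also have "\<dots> \<longleftrightarrow> (\<forall>vs. is_cycle G vs \<longrightarrow> length vs > g)"
    by (auto simp: girth_def le_INF_iff Suc_le_eq)
  finally show ?thesis .
qed

lemma girth_tanner_graph_gt_4_iff:
  "girth (tanner_graph M) > 4 \<longleftrightarrow>
     \<not> (\<exists>r r' c c'. r < dim_row M \<and> r' < dim_row M \<and> c < dim_col M \<and> c' < dim_col M \<and>
          r \<noteq> r' \<and> c \<noteq> c' \<and>
          M $$ (r, c) = 1 \<and> M $$ (r, c') = 1 \<and> M $$ (r', c) = 1 \<and> M $$ (r', c') = 1)"
    (is "_ \<longleftrightarrow> \<not> ?rectangle")
proof -
  let ?G = "tanner_graph M"
  have "(\<exists>vs. is_cycle ?G vs \<and> length vs \<le> 4) \<longleftrightarrow> ?rectangle"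
  proof
    assume "\<exists>vs. is_cycle ?G vs \<and> length vs \<le> 4"
    then obtain vs where vs: "is_cycle ?G vs" "length vs \<le> 4"
      by blast
    then have "length vs = 3 \<or> length vs = 4"
      by (auto simp: is_cycle_def)
    then consider (three) a b c where "vs = [a, b, c]" | (four) a b c d where "vs = [a, b, c, d]"
      by (auto simp: numeral_eq_Suc length_Suc_conv)
    then show ?rectangle
    proof cases
      \<comment> \<open>Two of any three vertices lie on the same side, yet all three would be
        pairwise adjacent.\<close>
      case three
      with vs(1) show ?thesis
        by (cases a; cases b; cases c) (auto simp: is_cycle_3)
    next
      \<comment> \<open>Only the two alternating patterns, starting at a row or at a column, survive
        the case split.\<close>
      case four
      with vs(1) show ?thesis
        by (cases a; cases b; cases c; cases d) (simp_all add: is_cycle_4, blast+)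
    qed
  next
    assume ?rectangle
    then obtain r r' c c' where
      "r < dim_row M" "r' < dim_row M" "c < dim_col M" "c' < dim_col M" "r \<noteq> r'" "c \<noteq> c'"
      "M $$ (r, c) = 1" "M $$ (r, c') = 1" "M $$ (r', c) = 1" "M $$ (r', c') = 1"
      by blast
    \<comment> \<open>The edges are settled by \<open>tanner_edge_iff\<close> before
      \<open>tanner_graph_def\<close> is unfolded for the vertex set.\<close>
    then have "is_cycle ?G [Inl r, Inr c, Inl r', Inr c']"
      unfolding is_cycle_4 by (simp, simp add: tanner_graph_def)
    then show "\<exists>vs. is_cycle ?G vs \<and> length vs \<le> 4"
      by (intro exI conjI) auto
  qed
  moreover have "girth ?G > 4 \<longleftrightarrow> \<not> (\<exists>vs. is_cycle ?G vs \<and> length vs \<le> 4)"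
    using girth_gt_iff[of 4 ?G] by (auto simp: numeral_eq_enat not_le)
  ultimately show ?thesis by simp
qed

lemma circ_perm_eq_1_iff:
  assumes "a < N" "b < N"
  shows "circ_perm N s $$ (a, b) = 1 \<longleftrightarrow> [int a = int b + s] (mod int N)"
proof -
  have "a = nat ((int b + s) mod int N) \<longleftrightarrow> int a = (int b + s) mod int N"
    using assms by (metis int_nat_eq nat_int of_nat_0_less_iff pos_mod_sign gr_zeroI not_less_zero)
  moreover have "nat ((int b + s) mod int N) < N"
    using assms by (simp add: nat_less_iff)
  ultimately show ?thesis
    using assms by (simp add: circ_perm_def cong_def)
qed

lemma circ_block_mat_dim [simp]:
  "dim_row (circ_block_mat N m n E) = m * N" "dim_col (circ_block_mat N m n E) = n * N"
  by (simp_all add: circ_block_mat_def)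

text \<open>Block offsets are multiples of \<open>N\<close>, so modulo \<open>N\<close> the
  positions inside a block may be replaced by the global indices.\<close>

lemma circ_block_mat_eq_1_iff:
  assumes "r < m * N" "c < n * N"
  shows "circ_block_mat N m n E $$ (r, c) = 1 \<longleftrightarrow>
    [int r - int c = E (r div N) (c div N)] (mod int N)"
proof -
  have "N > 0"
    using assms by (cases N) auto
  then have "circ_block_mat N m n E $$ (r, c) = 1 \<longleftrightarrow>
      [int (r mod N) = int (c mod N) + E (r div N) (c div N)] (mod int N)"
    using assms by (simp add: circ_block_mat_def circ_perm_eq_1_iff)
  also have "\<dots> \<longleftrightarrow> [int r = int c + E (r div N) (c div N)] (mod int N)"
    by (simp add: cong_def of_nat_mod mod_simps)
  also have "\<dots> \<longleftrightarrow> [int r - int c = E (r div N) (c div N)] (mod int N)"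
    by (simp add: cong_iff_dvd_diff algebra_simps)
  finally show ?thesis .
qed

text \<open>Quotient and remainder determine an index. This serves to show that distinct rows or
  columns of a rectangle lie in distinct blocks.\<close>

lemma eq_if_div_eq_cong:
  fixes a b N :: nat
  assumes "a div N = b div N" "[int a = int b] (mod int N)"
  shows "a = b"
  using assms unfolding cong_int_iff by (metis cong_def div_mult_mod_eq)

lemma girth_circ_block_mat_gt_4_iff:
  assumes "N \<ge> 1"
  shows "girth (tanner_graph (circ_block_mat N m n E)) > 4 \<longleftrightarrow>
    (\<forall>p < m. \<forall>q < m. p \<noteq> q \<longrightarrow> (\<forall>l < n. \<forall>l' < n. l \<noteq> l' \<longrightarrow>
       \<not> [E p l - E q l = E p l' - E q l'] (mod int N)))" (is "_ \<longleftrightarrow> ?distinct")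
proof -
  let ?M = "circ_block_mat N m n E"
  have "(\<exists>r r' c c'. r < m * N \<and> r' < m * N \<and> c < n * N \<and> c' < n * N \<and> r \<noteq> r' \<and> c \<noteq> c' \<and>
      ?M $$ (r, c) = 1 \<and> ?M $$ (r, c') = 1 \<and> ?M $$ (r', c) = 1 \<and> ?M $$ (r', c') = 1)
    \<longleftrightarrow> \<not> ?distinct" (is "?rectangle \<longleftrightarrow> _")
  proof
    assume ?rectangle
    then obtain r r' c c' where lt: "r < m * N" "r' < m * N" "c < n * N" "c' < n * N"
      and neq: "r \<noteq> r'" "c \<noteq> c'"
      and one: "?M $$ (r, c) = 1" "?M $$ (r, c') = 1" "?M $$ (r', c) = 1" "?M $$ (r', c') = 1"
      by blast
    define p q l l' where "p = r div N" and "q = r' div N" and "l = c div N" and "l' = c' div N"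
    have cong: "[int r - int c = E p l] (mod int N)" "[int r - int c' = E p l'] (mod int N)"
      "[int r' - int c = E q l] (mod int N)" "[int r' - int c' = E q l'] (mod int N)"
      using one lt by (simp_all add: circ_block_mat_eq_1_iff p_def q_def l_def l'_def)
    \<comment> \<open>Subtracting the conditions of two entries in one column eliminates the column
      index.\<close>
    have "[int r - int r' = E p l - E q l] (mod int N)" "[int r - int r' = E p l' - E q l'] (mod int N)"
      using cong_diff[OF cong(1,3)] cong_diff[OF cong(2,4)] by simp_all
    then have "[E p l - E q l = E p l' - E q l'] (mod int N)"
      using cong_sym cong_trans by blast
    moreover have "p < m" "q < m" "l < n" "l' < n"
      using lt by (simp_all add: p_def q_def l_def l'_def less_mult_imp_div_less)
    \<comment> \<open>A column of a circulant has a single 1, so within one block row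
      \<open>c\<close> would determine the row; the argument for \<open>l\<close> and
      \<open>l'\<close> is the same with rows and columns exchanged.\<close>
    moreover have "p \<noteq> q"
    proof
      assume "p = q"
      with cong(1,3) have "[int r - int c = int r' - int c] (mod int N)"
        using cong_sym cong_trans by blast
      then have "[int r = int r'] (mod int N)"
        by (simp add: cong_iff_dvd_diff)
      with \<open>p = q\<close> neq(1) show False
        using eq_if_div_eq_cong unfolding p_def q_def by blast
    qed
    moreover have "l \<noteq> l'"
    proof
      assume "l = l'"
      with cong(1,2) have "[int r - int c' = int r - int c] (mod int N)"
        using cong_sym cong_trans by blast
      then have "[int c = int c'] (mod int N)"
        by (simp add: cong_iff_dvd_diff)
      with \<open>l = l'\<close> neq(2) show False
        using eq_if_div_eq_cong unfolding l_def l'_def by blast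
    qed
    ultimately show "\<not> ?distinct" by blast
  next
    assume "\<not> ?distinct"
    then obtain p q l l' where lt: "p < m" "q < m" "l < n" "l' < n" and neq: "p \<noteq> q" "l \<noteq> l'"
      and cong: "[E p l - E q l = E p l' - E q l'] (mod int N)"
      by blast
    \<comment> \<open>The index in block \<open>b\<close> at the position given by the residue of
      \<open>s\<close>.\<close>
    define entry where "entry b s = b * N + nat (s mod int N)" for b :: nat and s :: int
    have rem: "nat (s mod int N) < N" for s
      using assms by (simp add: nat_less_iff)
    have div: "entry b s div N = b" for b s
      using rem[of s] by (simp add: entry_def)
    have entry_lt: "entry b s < d * N" if "b < d" for b s d
      using that assms div[of b s] by (simp add: div_less_iff_less_mult[symmetric])
    have entry_cong: "[int (entry b s) = s] (mod int N)" for b s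
      using assms by (simp add: entry_def cong_def)
    have one: "?M $$ (entry b s, entry d t) = 1"
      if "b < m" "d < n" "[s - t = E b d] (mod int N)" for b s d t
      using that cong_diff[OF entry_cong entry_cong, of b s d t]
      by (simp add: circ_block_mat_eq_1_iff entry_lt div cong_trans)
    \<comment> \<open>With \<open>c\<close> at position 0, its two entries force the positions of
      \<open>r\<close> and \<open>r'\<close>; the entry at \<open>(r, c')\<close> then forces that
      of \<open>c'\<close>. The fourth entry is where \<open>cong\<close> enters.\<close>
    define r r' c c' where "r = entry p (E p l)" and "r' = entry q (E q l)"
      and "c = entry l 0" and "c' = entry l' (E p l - E p l')"
    have "?M $$ (r, c) = 1" "?M $$ (r, c') = 1" "?M $$ (r', c) = 1"
      unfolding r_def r'_def c_def c'_def using lt by (simp_all add: one)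
    moreover have "[E q l - (E p l - E p l') = E q l'] (mod int N)"
      using cong by (simp add: cong_iff_dvd_diff dvd_diff_commute algebra_simps)
    then have "?M $$ (r', c') = 1"
      unfolding r'_def c'_def using lt by (simp add: one)
    moreover have "r \<noteq> r'" "c \<noteq> c'"
      using neq div unfolding r_def r'_def c_def c'_def by metis+
    moreover have "r < m * N" "r' < m * N" "c < n * N" "c' < n * N"
      using lt by (simp_all add: entry_lt r_def r'_def c_def c'_def)
    ultimately show ?rectangle by blast
  qed
  then show ?thesis
    unfolding girth_tanner_graph_gt_4_iff circ_block_mat_dim by blast
qed

text \<open>Passes from indices starting at 1 to block columns starting at 0, matching the
  \<open>Suc l\<close> in \<open>H4\<close>.\<close>

lemma maximal_size_iff:
  "maximal_size N n f \<longleftrightarrow>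
    (\<forall>l < n. \<forall>l' < n. l \<noteq> l' \<longrightarrow> \<not> [f (Suc l) = f (Suc l')] (mod int N))"
proof -
  have "{1..n} = Suc ` {..<n}"
    by (simp add: image_Suc_lessThan)
  then show ?thesis
    by (auto simp: maximal_size_def)
qed

lemma maximal_size_uminus: "maximal_size N n (\<lambda>l. - f l) \<longleftrightarrow> maximal_size N n f"
  by (simp add: maximal_size_def cong_minus_minus_iff)

text \<open>Negation is injective modulo \<open>N\<close>. This identifies the conditions for
  \<open>(p, q)\<close> and \<open>(q, p)\<close>, leaving six of the twelve ordered pairs of block
  rows.\<close>

lemma maximal_size_diff_commute:
  "maximal_size N n (\<lambda>l. f l - g l) \<longleftrightarrow> maximal_size N n (\<lambda>l. g l - f l)"
  using maximal_size_uminus[of N n "\<lambda>l. f l - g l"] by simp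

theorem theorem32:
  fixes n\<^sub>v N :: nat and i j k :: "nat \<Rightarrow> int"
  assumes "n\<^sub>v \<ge> 1" and "N \<ge> 1"
    and "[i 1 = 0] (mod int N)" and "[j 1 = 0] (mod int N)" and "[k 1 = 0] (mod int N)"
  shows "girth (tanner_graph (H4 N n\<^sub>v i j k)) > 4 \<longleftrightarrow>
    maximal_size N n\<^sub>v i \<and> maximal_size N n\<^sub>v j \<and> maximal_size N n\<^sub>v k \<and>
    maximal_size N n\<^sub>v (\<lambda>l. i l - j l) \<and>
    maximal_size N n\<^sub>v (\<lambda>l. i l - k l) \<and>
    maximal_size N n\<^sub>v (\<lambda>l. j l - k l)"
proof -
  let ?F = "\<lambda>p. [\<lambda>_. 0, i, j, k] ! p"
  have "girth (tanner_graph (H4 N n\<^sub>v i j k)) > 4 \<longleftrightarrow>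
      (\<forall>p < 4. \<forall>q < 4. p \<noteq> q \<longrightarrow> maximal_size N n\<^sub>v (\<lambda>l. ?F p l - ?F q l))"
    unfolding H4_def girth_circ_block_mat_gt_4_iff[OF assms(2)] maximal_size_iff by (rule refl)
  \<comment> \<open>The first block row has exponents 0, so its differences with the others are the
    three given sequences up to sign.\<close>
  also have "\<dots> \<longleftrightarrow> maximal_size N n\<^sub>v i \<and> maximal_size N n\<^sub>v j \<and> maximal_size N n\<^sub>v k \<and>
      maximal_size N n\<^sub>v (\<lambda>l. i l - j l) \<and> maximal_size N n\<^sub>v (\<lambda>l. i l - k l) \<and>
      maximal_size N n\<^sub>v (\<lambda>l. j l - k l)"
    using maximal_size_diff_commute[of N n\<^sub>v i j] maximal_size_diff_commute[of N n\<^sub>v i k]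
      maximal_size_diff_commute[of N n\<^sub>v j k]
    by (auto simp: numeral_eq_Suc All_less_Suc maximal_size_uminus)
  finally show ?thesis .
qed

end
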